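(* Let $J_1,\dots,J_n$ be the objective functions of an $n$-player Markov game, where agent $i$ has parameters $\boldsymbol{\theta}_i\in\mathbb{R}^{d_i}$ and learning rate $\eta_i$. Suppose that for every agent $i$ the gradient $\nabla_{\boldsymbol{\theta}_i}J_i(\boldsymbol{\theta}_i,\boldsymbol{\theta}_{-i})$ is $L_i$-Lipschitz with respect to $\boldsymbol{\theta}_{-i}$, i.e. $$\|\nabla_{\boldsymbol{\theta}_i}J_i(\boldsymbol{\theta}_i,\boldsymbol{\theta}_{-i,1})-\nabla_{\boldsymbol{\theta}_i}J_i(\boldsymbol{\theta}_i,\boldsymbol{\theta}_{-i,2})\|\le L_i\|\boldsymbol{\theta}_{-i,1}-\boldsymbol{\theta}_{-i,2}\|$$ for all $\boldsymbol{\theta}_i$ and all $\boldsymbol{\theta}_{-i,1},\boldsymbol{\theta}_{-i,2}$. Let $L:=\max_i L_i$, $\eta:=\max_i\eta_i$ and $\nabla_{max}:=\max_{i,\boldsymbol{\theta}_i,\boldsymbol{\theta}_{-i}}\|\nabla_{\boldsymbol{\theta}_i}J_i(\boldsymbol{\theta}_i,\boldsymbol{\theta}_{-i})\|$. Let $\boldsymbol{\theta}=[\boldsymbol{\theta}_1,\dots,\boldsymbol{\theta}_n]^T\in\mathbb{R}^{\sum_i d_i}$ be the combined parameter vector, and let $\boldsymbol{\theta}^{(k)}$ be the combined parameter vector after $k$ steps of $K$-level policy gradient (KPG) reasoning started from $\boldsymbol{\theta}^{(0)}=\boldsymbol{\theta}$. Then for every $k\ge 1$, $$\|\boldsymbol{\theta}^{(k)}-\boldsymbol{\theta}^{(k-1)}\|\le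 \eta(\eta L)^{k-1}n(n-1)^{k-1}\nabla_{max}.$$ Assume moreover that $\eta<\frac{1}{L(n-1)}$. Then the sequence $\{\boldsymbol{\theta}^{(k)}\}_{k=0}^{\infty}$ is convergent and Cauchy, i.e. for every $\epsilon>0$ there exists $C\in\mathbb{N}$ such that $a>b>C$ implies $\|\boldsymbol{\theta}^{(a)}-\boldsymbol{\theta}^{(b)}\|<\epsilon$; in particular the limit $\boldsymbol{\theta}^{(\infty)}=\lim_{k\to\infty}\boldsymbol{\theta}^{(k)}$ exists.
   Context: Setting: an $n$-agent Markov game with agent set $\mathcal{I}=\{1,\dots,n\}$. Agent $i$ has a policy $\pi_i$ parameterized by $\boldsymbol{\theta}_i\in\mathbb{R}^{d_i}$ and maximizes its discounted objective $J_i(\boldsymbol{\theta}_i,\boldsymbol{\theta}_{-i})=\mathbb{E}\left[\sum_{t=0}^{\infty}\gamma^t r_{t,i}\right]$, where the expectation is over trajectories induced by the policies, the initial state distribution and the transition function, $r_{t,i}$ is the reward of agent $i$ at time $t$, and $\boldsymbol{\theta}_{-i}$ denotes the parameters of all agents other than $i$. Each agent has a learning rate $\eta_i>0$. The quantity $\nabla_{max}$ is assumed to exist (be finite). KPG recursion: starting from $\boldsymbol{\theta}_i^{(0)}=\boldsymbol{\theta}_i$, for $k=1,2,\dots$ and all $i\in\mathcal{I}$ simultaneously, $$\boldsymbol{\theta}_i^{(k)}=\boldsymbol{\theta}_i+\eta_i\nabla_{\boldsymbol{\theta}_i}J_i(\boldsymbol{\theta}_i,\boldsymbol{\theta}_{-i}^{(k-1)}).$$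 Every level updates from the same initial parameters $\boldsymbol{\theta}_i$, with the gradient taken in the first argument at $\boldsymbol{\theta}_i$. The combined vector is $\boldsymbol{\theta}^{(k)}=[\boldsymbol{\theta}_1^{(k)},\dots,\boldsymbol{\theta}_n^{(k)}]^T$. Norms are Euclidean. *)

theory Defs
  imports "HOL-Probability.Probability"
begin

text \<open>
  A Markov game with a finite agent type \<^typ>\<open>'i\<close>. State and action spaces are arbitrary
  measurable spaces; all action spaces are carved out of one type \<^typ>\<open>'a\<close>. Rewards may
  depend on the current state, the joint action and the next state.
\<close>

record ('s, 'a, 'i) markov_game =
  states :: "'s measure"
  actions :: "'i \<Rightarrow> 'a measure"
  init :: "'s measure"
  trans :: "'s \<times> ('i \<Rightarrow> 'a) \<Rightarrow> 's measure"
  reward :: "'i \<Rightarrow> 's \<times> ('i \<Rightarrow> 'a) \<times> 's \<Rightarrow> real"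
  discount :: real

definition step_space :: "('s, 'a, 'i) markov_game \<Rightarrow> ('s \<times> ('i \<Rightarrow> 'a)) measure" where
  "step_space G = states G \<Otimes>\<^sub>M PiM UNIV (actions G)"

definition is_markov_game :: "('s, 'a, 'i::finite) markov_game \<Rightarrow> bool" where
  "is_markov_game G \<longleftrightarrow>
     init G \<in> space (prob_algebra (states G)) \<and>
     trans G \<in> step_space G \<rightarrow>\<^sub>M prob_algebra (states G) \<and>
     (\<forall>i. reward G i \<in> borel_measurable (states G \<Otimes>\<^sub>M (PiM UNIV (actions G) \<Otimes>\<^sub>M states G))) \<and>
     0 \<le> discount G \<and> discount G \<le> 1"

definition is_policy :: "('s, 'a, 'i) markov_game \<Rightarrow> 'i \<Rightarrow> ('s \<Rightarrow> 'a measure) \<Rightarrow> bool" where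
  "is_policy G i \<pi> \<longleftrightarrow> \<pi> \<in> states G \<rightarrow>\<^sub>M prob_algebra (actions G i)"

text \<open>Given the state, the agents draw their actions independently of each other.\<close>

definition act_kernel ::
  "('s, 'a, 'i::finite) markov_game \<Rightarrow> ('i \<Rightarrow> 's \<Rightarrow> 'a measure) \<Rightarrow> 's \<Rightarrow> ('s \<times> ('i \<Rightarrow> 'a)) measure"
where
  "act_kernel G \<pi> s = distr (PiM UNIV (\<lambda>i. \<pi> i s)) (step_space G) (Pair s)"

text \<open>
  Conditional law of (state, joint action) at time \<open>t\<close>, given the history \<open>h 0, \<dots>, h (t - 1)\<close>.
\<close>

definition step_kernel ::
  "('s, 'a, 'i::finite) markov_game \<Rightarrow> ('i \<Rightarrow> 's \<Rightarrow> 'a measure) \<Rightarrow>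
     nat \<Rightarrow> (nat \<Rightarrow> 's \<times> ('i \<Rightarrow> 'a)) \<Rightarrow> ('s \<times> ('i \<Rightarrow> 'a)) measure"
where
  "step_kernel G \<pi> t h = (if t = 0 then init G else trans G (h (t - 1))) \<bind> act_kernel G \<pi>"

text \<open>The law of the infinite trajectory, by the Ionescu-Tulcea extension theorem.\<close>

definition trajectory_measure ::
  "('s, 'a, 'i::finite) markov_game \<Rightarrow> ('i \<Rightarrow> 's \<Rightarrow> 'a measure) \<Rightarrow>
     (nat \<Rightarrow> 's \<times> ('i \<Rightarrow> 'a)) measure"
where
  "trajectory_measure G \<pi> =
     projective_family.lim UNIV
       (Ionescu_Tulcea.CI (step_kernel G \<pi>) (\<lambda>_. step_space G)) (\<lambda>_. step_space G)"

definition discounted_reward ::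
  "('s, 'a, 'i) markov_game \<Rightarrow> 'i \<Rightarrow> (nat \<Rightarrow> 's \<times> ('i \<Rightarrow> 'a)) \<Rightarrow> nat \<Rightarrow> real"
where
  "discounted_reward G i \<omega> t =
     discount G ^ t * reward G i (fst (\<omega> t), snd (\<omega> t), fst (\<omega> (Suc t)))"

text \<open>
  Combined parameter vectors live in \<^typ>\<open>real ^ 'c\<close>, where the coordinate type \<^typ>\<open>'c\<close> is split
  among the agents by \<open>own :: 'c \<Rightarrow> 'i\<close>; so \<open>d\<^sub>i = card {c. own c = i}\<close> varies freely with \<open>i\<close> and
  \<open>CARD('c)\<close> is the sum of the \<open>d\<^sub>i\<close>. The spaces of \<open>\<theta>\<^sub>i\<close> and of \<open>\<theta>\<^sub>-\<^sub>i\<close> are identified, isometrically,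
  with the coordinate subspaces that are the ranges of the following two projections.
\<close>

definition own_part :: "('c \<Rightarrow> 'i) \<Rightarrow> 'i \<Rightarrow> real ^ 'c \<Rightarrow> real ^ ('c::finite)" where
  "own_part own i x = (\<chi> c. if own c = i then x $ c else 0)"

definition others_part :: "('c \<Rightarrow> 'i) \<Rightarrow> 'i \<Rightarrow> real ^ 'c \<Rightarrow> real ^ ('c::finite)" where
  "others_part own i x = (\<chi> c. if own c = i then 0 else x $ c)"

definition profile ::
  "('c \<Rightarrow> 'i) \<Rightarrow> ('i \<Rightarrow> real ^ 'c \<Rightarrow> 's \<Rightarrow> 'a measure) \<Rightarrow> real ^ ('c::finite) \<Rightarrow> 'i \<Rightarrow> 's \<Rightarrow> 'a measure"
where
  "profile own pol x i = pol i (own_part own i x)"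

definition objective ::
  "('s, 'a, 'i::finite) markov_game \<Rightarrow> ('c \<Rightarrow> 'i) \<Rightarrow> ('i \<Rightarrow> real ^ 'c \<Rightarrow> 's \<Rightarrow> 'a measure) \<Rightarrow>
     'i \<Rightarrow> real ^ ('c::finite) \<Rightarrow> real"
where
  "objective G own pol i x =
     (\<integral>\<omega>. (\<Sum>t. discounted_reward G i \<omega> t) \<partial>trajectory_measure G (profile own pol x))"

text \<open>
  Without this condition \<^const>\<open>objective\<close> could be a default value of a divergent series or of a
  non-existing integral.
\<close>

definition objective_exists ::
  "('s, 'a, 'i::finite) markov_game \<Rightarrow> ('c \<Rightarrow> 'i) \<Rightarrow> ('i \<Rightarrow> real ^ 'c \<Rightarrow> 's \<Rightarrow> 'a measure) \<Rightarrow>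
     'i \<Rightarrow> real ^ ('c::finite) \<Rightarrow> bool"
where
  "objective_exists G own pol i x \<longleftrightarrow>
     (AE \<omega> in trajectory_measure G (profile own pol x). summable (discounted_reward G i \<omega>)) \<and>
     integrable (trajectory_measure G (profile own pol x)) (\<lambda>\<omega>. \<Sum>t. discounted_reward G i \<omega> t)"

text \<open>
  \<open>has_own_gradient own f i x y D\<close>: \<open>D\<close> is the gradient in \<open>\<theta>\<^sub>i\<close> of \<open>f (\<theta>\<^sub>i, \<theta>\<^sub>-\<^sub>i)\<close> at the point whose
  \<open>\<theta>\<^sub>i\<close> is that of \<open>x\<close> and whose \<open>\<theta>\<^sub>-\<^sub>i\<close> is that of \<open>y\<close>. The differentiated function ignores the
  coordinates of the other agents, so \<open>D\<close> vanishes there.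
\<close>

definition has_own_gradient ::
  "('c \<Rightarrow> 'i) \<Rightarrow> (real ^ 'c \<Rightarrow> real) \<Rightarrow> 'i \<Rightarrow> real ^ 'c \<Rightarrow> real ^ 'c \<Rightarrow> real ^ ('c::finite) \<Rightarrow> bool"
where
  "has_own_gradient own f i x y D \<longleftrightarrow>
     GDERIV (\<lambda>z. f (own_part own i z + others_part own i y)) x :> D"

definition own_gradient ::
  "('c \<Rightarrow> 'i) \<Rightarrow> (real ^ 'c \<Rightarrow> real) \<Rightarrow> 'i \<Rightarrow> real ^ 'c \<Rightarrow> real ^ 'c \<Rightarrow> real ^ ('c::finite)"
where
  "own_gradient own f i x y = (THE D. has_own_gradient own f i x y D)"

primrec kpg ::
  "('c \<Rightarrow> 'i) \<Rightarrow> ('i \<Rightarrow> real ^ 'c \<Rightarrow> real) \<Rightarrow> ('i \<Rightarrow> real) \<Rightarrow> real ^ 'c \<Rightarrow> nat \<Rightarrow> real ^ ('c::finite)"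
where
  "kpg own J \<eta> \<theta> 0 = \<theta>"
| "kpg own J \<eta> \<theta> (Suc k) =
     (\<chi> c. \<theta> $ c + \<eta> (own c) * own_gradient own (J (own c)) (own c) \<theta> (kpg own J \<eta> \<theta> k) $ c)"


lemma act_kernel_measurable:
  fixes G :: "('s, 'a, 'i::finite) markov_game"
  assumes pol: "\<And>i. is_policy G i (\<pi> i)"
  shows "act_kernel G \<pi> \<in> states G \<rightarrow>\<^sub>M prob_algebra (step_space G)"
proof -
  have pm: "\<pi> i \<in> states G \<rightarrow>\<^sub>M prob_algebra (actions G i)" for i
    using pol by (simp add: is_policy_def)
  have ps: "prob_space (\<pi> i s)" and st: "sets (\<pi> i s) = sets (actions G i)"
    if "s \<in> space (states G)" for i s
    using measurable_space[OF pm that] by (auto simp: space_prob_algebra)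
  let ?A = "PiM UNIV (actions G)"
  have joint: "(\<lambda>s. PiM UNIV (\<lambda>i. \<pi> i s)) \<in> states G \<rightarrow>\<^sub>M prob_algebra ?A"
  proof (rule measurable_prob_algebra_generated
      [OF sets_PiM Int_stable_prod_algebra prod_algebra_sets_into_space])
    fix s assume "s \<in> space (states G)"
    then show "prob_space (PiM UNIV (\<lambda>i. \<pi> i s))"
      by (intro prob_space_PiM ps)
  next
    fix s assume "s \<in> space (states G)"
    then show "sets (PiM UNIV (\<lambda>i. \<pi> i s)) = sets ?A"
      by (intro sets_PiM_cong st refl)
  next
    fix B assume "B \<in> prod_algebra UNIV (actions G)"
    then obtain X where B: "B = (\<Pi>\<^sub>E i\<in>UNIV. X i)" and X: "\<And>i. X i \<in> sets (actions G i)"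
      by (auto simp: prod_algebra_eq_finite)
    have "emeasure (PiM UNIV (\<lambda>i. \<pi> i s)) B = (\<Prod>i\<in>UNIV. emeasure (\<pi> i s) (X i))"
      if s: "s \<in> space (states G)" for s
    proof -
      interpret product_sigma_finite "\<lambda>i. \<pi> i s"
        unfolding product_sigma_finite_def
        using ps[OF s] by (simp add: prob_space_imp_sigma_finite)
      show ?thesis unfolding B by (rule emeasure_PiM) (auto simp: st[OF s] X)
    qed
    moreover have "(\<lambda>s. \<Prod>i\<in>UNIV. emeasure (\<pi> i s) (X i)) \<in> borel_measurable (states G)"
      using X measurable_prob_algebraD[OF pm]
      by (intro borel_measurable_prod_ennreal
            measurable_compose[OF _ measurable_emeasure_subprob_algebra]) auto
    ultimately show "(\<lambda>s. emeasure (PiM UNIV (\<lambda>i. \<pi> i s)) B) \<in> borel_measurable (states G)"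
      by (simp cong: measurable_cong)
  qed
  show ?thesis
    unfolding act_kernel_def [abs_def]
    by (rule measurable_distr_prob_space2[OF joint]) (simp add: step_space_def case_prod_Pair)
qed

lemma step_kernel_Ionescu_Tulcea:
  fixes G :: "('s, 'a, 'i::finite) markov_game"
  assumes G: "is_markov_game G" and pol: "\<And>i. is_policy G i (\<pi> i)"
  shows "Ionescu_Tulcea (step_kernel G \<pi>) (\<lambda>_. step_space G)"
proof -
  note [measurable] = act_kernel_measurable[OF pol]
  have tr[measurable]: "trans G \<in> step_space G \<rightarrow>\<^sub>M prob_algebra (states G)"
    and init: "init G \<in> space (prob_algebra (states G))"
    using G by (auto simp: is_markov_game_def)
  have K: "step_kernel G \<pi> t \<in> PiM {0..<t} (\<lambda>_. step_space G) \<rightarrow>\<^sub>M prob_algebra (step_space G)" for t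
  proof (cases "t = 0")
    case True
    then show ?thesis
      unfolding step_kernel_def [abs_def] using init
      by (intro measurable_bind_prob_space[where N = "states G"] act_kernel_measurable[OF pol])
         simp_all
  next
    case False
    have "(\<lambda>h. h (t - 1)) \<in> PiM {0..<t} (\<lambda>_. step_space G) \<rightarrow>\<^sub>M step_space G"
      using False by (intro measurable_component_singleton) auto
    from measurable_compose[OF this tr]
    have "(\<lambda>h. trans G (h (t - 1)))
            \<in> PiM {0..<t} (\<lambda>_. step_space G) \<rightarrow>\<^sub>M prob_algebra (states G)" .
    then show ?thesis
      unfolding step_kernel_def [abs_def] using False
      by (simp add: measurable_bind_prob_space[OF _ act_kernel_measurable[OF pol]])
  qed
  show ?thesis
  proof (rule Ionescu_Tulcea.intro)
    show "step_kernel G \<pi> t \<in> PiM {0..<t} (\<lambda>_. step_space G) \<rightarrow>\<^sub>M subprob_algebra (step_space G)" for t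
      by (rule measurable_prob_algebraD[OF K])
    show "prob_space (step_kernel G \<pi> t h)" if "h \<in> space (PiM {0..<t} (\<lambda>_. step_space G))" for t h
      using measurable_space[OF K that] by (simp add: space_prob_algebra)
  qed
qed

lemma GDERIV_unique:
  assumes "GDERIV f x :> D" "GDERIV f x :> D'"
  shows "D = D'"
proof -
  have "(\<lambda>h. inner h D) = (\<lambda>h. inner h D')"
    using assms has_derivative_unique unfolding gderiv_def by blast
  then have "inner (D - D') D = inner (D - D') D'"
    by meson
  then show ?thesis
    by (metis eq_iff_diff_eq_0 inner_diff_right inner_eq_zero_iff)
qed

lemma own_gradient_eq: "has_own_gradient own f i x y D \<Longrightarrow> own_gradient own f i x y = D"
  unfolding own_gradient_def has_own_gradient_def by (blast intro: GDERIV_unique)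

lemma own_gradient_support:
  assumes "has_own_gradient own f i x y D"
  shows "own_part own i D = D"
proof -
  let ?g = "\<lambda>z. f (own_part own i z + others_part own i y)"
  have g: "(?g has_derivative (\<lambda>h. inner h D)) (at x)"
    using assms by (simp add: has_own_gradient_def gderiv_def)
  have "D $ c = 0" if "own c \<noteq> i" for c
  proof -
    have "own_part own i (x + t *\<^sub>R axis c 1) = own_part own i x" for t
      using that by (auto simp: own_part_def vec_eq_iff axis_def)
    moreover have "((\<lambda>t. x + t *\<^sub>R axis c 1) has_derivative (\<lambda>t. t *\<^sub>R axis c 1)) (at 0)"
      by (auto intro!: derivative_eq_intros)
    moreover have "((\<lambda>t. ?g (x + t *\<^sub>R axis c 1)) has_derivative (\<lambda>t. inner (t *\<^sub>R axis c 1) D)) (at 0)"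
      by (rule has_derivative_compose[OF calculation(2)]) (simp add: g)
    ultimately have "((\<lambda>t::real. ?g x) has_derivative (\<lambda>t. inner (t *\<^sub>R axis c 1) D)) (at 0)"
      by simp
    then have "(\<lambda>t::real. inner (t *\<^sub>R axis c 1) D) = (\<lambda>t. 0)"
      using has_derivative_unique has_derivative_const by blast
    then have "inner (1 *\<^sub>R axis c 1) D = 0"
      by meson
    then show ?thesis
      by (simp add: inner_axis')
  qed
  then show ?thesis
    by (auto simp: own_part_def vec_eq_iff)
qed

end

theory Submission
  imports Defs
begin

text \<open>
  Write \<open>a i k\<close> for the norm of agent \<open>i\<close>'s block of the step from level \<open>k\<close> to level \<open>k + 1\<close>. Every level updates from the same
  initial point, so in the difference of two consecutive levels that point cancels and only a
  difference of gradients remains; the Lipschitz condition and the triangle inequality over the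
  \<open>n - 1\<close> other blocks give \<open>a i (k + 1) \<le> \<eta> L (\<Sum>j\<noteq>i. a j k)\<close>. Hence all blocks decay at the
  geometric rate \<open>\<eta> L (n - 1)\<close>, and the increments are summable if this rate is below 1.
\<close>

text \<open>The blocks have disjoint supports and add up to \<open>x\<close>. Passing from a uniform
  bound on the blocks to the whole vector in this way produces the factor \<open>n\<close>.\<close>

lemma norm_le_sum_own_part:
  fixes own :: "'c::finite \<Rightarrow> 'i::finite"
  shows "norm x \<le> (\<Sum>i\<in>UNIV. norm (own_part own i x))"
proof -
  have "x = (\<Sum>i\<in>UNIV. own_part own i x)"
    by (simp add: vec_eq_iff own_part_def)
  then have "norm x = norm (\<Sum>i\<in>UNIV. own_part own i x)"
    by simp
  also have "\<dots> \<le> (\<Sum>i\<in>UNIV. norm (own_part own i x))"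
    by (rule norm_sum)
  finally show ?thesis .
qed

text \<open>The part seen by the others is the sum of the remaining \<open>n - 1\<close> blocks;
  this is the source of the factor \<open>n - 1\<close> gained per level.\<close>

lemma norm_others_part_le:
  fixes own :: "'c::finite \<Rightarrow> 'i::finite"
  shows "norm (others_part own i x) \<le> (\<Sum>j\<in>UNIV - {i}. norm (own_part own j x))"
proof -
  have "others_part own i x = (\<Sum>j\<in>UNIV - {i}. own_part own j x)"
    by (simp add: vec_eq_iff own_part_def others_part_def)
  then show ?thesis
    by (simp add: norm_sum)
qed

lemma norm_own_part_le: "norm (own_part own i x) \<le> norm x"
  by (rule norm_le_componentwise_cart) (simp add: own_part_def)

lemma others_part_diff: "others_part own i (x - y) = others_part own i x - others_part own i y"
  by (simp add: others_part_def vec_eq_iff)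

text \<open>The increments are dominated by a geometric series, hence summable in a complete space,
  and their partial sums telescope to \<open>X m - X 0\<close>.\<close>

lemma convergent_if_geometric_increments:
  fixes X :: "nat \<Rightarrow> 'a::banach"
  assumes bound: "\<And>k. norm (X (Suc k) - X k) \<le> c * r ^ k" and r: "\<bar>r\<bar> < 1"
  shows "convergent X"
proof -
  have "summable (\<lambda>k. c * r ^ k)"
    using r by (intro summable_mult summable_geometric) simp
  then have "summable (\<lambda>k. X (Suc k) - X k)"
    by (rule summable_comparison_test') (rule bound)
  then have "convergent (\<lambda>m. X m - X 0)"
    by (simp add: summable_iff_convergent sum_lessThan_telescope)
  then have "convergent (\<lambda>m. (X m - X 0) + X 0)"
    by (rule convergent_add) (rule convergent_const)
  then show ?thesis by simp
qed

text \<open>An abstract form of the recursion: \<open>g i\<close> stands for the gradient of agent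
  \<open>i\<close> with its own parameters frozen at the initial point, so it depends on the level
  only through \<open>X k\<close>. It may have entries outside block \<open>i\<close>, but the
  recursion reads only that block.\<close>

context
  fixes own :: "'c::finite \<Rightarrow> 'i::finite"
    and g :: "'i \<Rightarrow> real ^ 'c \<Rightarrow> real ^ 'c"
    and \<eta> :: "'i \<Rightarrow> real" and h l B :: real
    and X :: "nat \<Rightarrow> real ^ 'c"
  assumes step: "\<And>k. X (Suc k) = (\<chi> c. X 0 $ c + \<eta> (own c) * g (own c) (X k) $ c)"
    and rate_nonneg: "\<And>i. 0 \<le> \<eta> i" and rate_le: "\<And>i. \<eta> i \<le> h"
    and l_nonneg: "0 \<le> l"
    and lip: "\<And>i x y. norm (g i x - g i y) \<le> l * norm (others_part own i x - others_part own i y)"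
    and bound: "\<And>i x. norm (g i x) \<le> B"
begin

text \<open>Agent \<open>i\<close> at one level is controlled by all other agents at the previous
  level, so the induction needs the bound for every agent at once. As the bound is the same for all
  of them, the sum over the others is a multiplication by \<open>n - 1\<close>.\<close>

lemma own_part_increment_le:
  "norm (own_part own i (X (Suc k) - X k)) \<le> h * B * (h * l * (real CARD('i) - 1)) ^ k"
proof (induction k arbitrary: i)
  case 0
  have "own_part own i (X (Suc 0) - X 0) = \<eta> i *\<^sub>R own_part own i (g i (X 0))"
    by (simp add: step own_part_def vec_eq_iff)
  then have "norm (own_part own i (X (Suc 0) - X 0)) = \<eta> i * norm (own_part own i (g i (X 0)))"
    using rate_nonneg by simp
  also have "\<dots> \<le> h * B"
    using rate_nonneg[of i] rate_le[of i] norm_own_part_le[of own i "g i (X 0)"] bound[of i "X 0"]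
    by (intro mult_mono) auto
  finally show ?case by simp
next
  case (Suc k)
  have h: "0 \<le> h"
    using rate_nonneg rate_le order_trans by blast
  \<comment> \<open>Both levels restart from \<open>X 0\<close>, which cancels; only a difference of
    gradients is left for the Lipschitz condition.\<close>
  have "own_part own i (X (Suc (Suc k)) - X (Suc k))
      = \<eta> i *\<^sub>R own_part own i (g i (X (Suc k)) - g i (X k))"
    unfolding step[of "Suc k"] step[of k]
    by (simp add: own_part_def vec_eq_iff algebra_simps)
  then have "norm (own_part own i (X (Suc (Suc k)) - X (Suc k)))
      = \<eta> i * norm (own_part own i (g i (X (Suc k)) - g i (X k)))"
    using rate_nonneg by simp
  also have "\<dots> \<le> h * (l * norm (others_part own i (X (Suc k) - X k)))"
    using rate_nonneg[of i] rate_le[of i] h lip[of i "X (Suc k)" "X k"]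
      order_trans[OF norm_own_part_le]
    by (intro mult_mono) (auto simp: others_part_diff)
  also have "\<dots> \<le> h * (l * (\<Sum>j\<in>UNIV - {i}. norm (own_part own j (X (Suc k) - X k))))"
    by (intro mult_left_mono norm_others_part_le l_nonneg h)
  also have "\<dots> \<le> h * (l * (\<Sum>j\<in>UNIV - {i}. h * B * (h * l * (real CARD('i) - 1)) ^ k))"
    by (intro mult_left_mono sum_mono Suc.IH l_nonneg h)
  also have "\<dots> = h * B * (h * l * (real CARD('i) - 1)) ^ Suc k"
    by (simp add: card_Diff_singleton of_nat_diff Suc_leI)
  finally show ?case .
qed

lemma increment_le:
  "norm (X (Suc k) - X k) \<le> real CARD('i) * (h * B * (h * l * (real CARD('i) - 1)) ^ k)"
proof -
  have "norm (X (Suc k) - X k) \<le> (\<Sum>i\<in>UNIV. norm (own_part own i (X (Suc k) - X k)))"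
    by (rule norm_le_sum_own_part)
  also have "\<dots> \<le> (\<Sum>i\<in>(UNIV::'i set). h * B * (h * l * (real CARD('i) - 1)) ^ k)"
    by (intro sum_mono own_part_increment_le)
  finally show ?thesis by simp
qed

end

theorem theorem4p2:
  fixes G :: "('s, 'a, 'i::finite) markov_game"
    and own :: "'c::finite \<Rightarrow> 'i"
    and pol :: "'i \<Rightarrow> real ^ 'c \<Rightarrow> 's \<Rightarrow> 'a measure"
    and \<eta> L :: "'i \<Rightarrow> real"
    and \<theta> :: "real ^ 'c"
  defines "J \<equiv> objective G own pol"
    and "grad \<equiv> (\<lambda>i. own_gradient own (objective G own pol i) i)"
    and "n \<equiv> real CARD('i)"
    and "\<eta>max \<equiv> Max (range \<eta>)"
    and "Lmax \<equiv> Max (range L)"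
    and "gmax \<equiv> (SUP (i, x, y). norm (own_gradient own (objective G own pol i) i x y))"
    and "\<Theta> \<equiv> kpg own (objective G own pol) \<eta> \<theta>"
  assumes game: "is_markov_game G"
    and policies: "\<And>i x. is_policy G i (pol i (own_part own i x))"
    and objectives: "\<And>i x. objective_exists G own pol i x"
    and gradients: "\<And>i x y. \<exists>D. has_own_gradient own (J i) i x y D"
    and rates: "\<And>i. \<eta> i > 0"
    and L_nonneg: "\<And>i. L i \<ge> 0"
    and lipschitz: "\<And>i x y1 y2.
      norm (grad i x y1 - grad i x y2) \<le> L i * norm (others_part own i y1 - others_part own i y2)"
    and gmax_finite: "bdd_above (range (\<lambda>(i, x, y). norm (grad i x y)))"
  shows "(\<forall>k\<ge>1. norm (\<Theta> k - \<Theta> (k - 1))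
            \<le> \<eta>max * (\<eta>max * Lmax) ^ (k - 1) * n * (n - 1) ^ (k - 1) * gmax) \<and>
         ((Lmax * (n - 1) \<noteq> 0 \<longrightarrow> \<eta>max < 1 / (Lmax * (n - 1))) \<longrightarrow>
            convergent \<Theta> \<and> \<Theta> \<longlonglongrightarrow> lim \<Theta> \<and> Cauchy \<Theta> \<and>
            (\<forall>\<epsilon>>0. \<exists>C. \<forall>a b. a > b \<and> b > C \<longrightarrow> norm (\<Theta> a - \<Theta> b) < \<epsilon>))"
proof -
  have n: "1 \<le> n"
    by (simp add: n_def Suc_leI)
  have \<eta>max: "\<eta> i \<le> \<eta>max" for i
    by (simp add: \<eta>max_def)
  have Lmax: "L i \<le> Lmax" for i
    by (simp add: Lmax_def)
  have pos: "0 < \<eta>max" "0 \<le> Lmax"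
    using less_le_trans[OF rates \<eta>max] order_trans[OF L_nonneg Lmax] by auto
  have step: "\<Theta> (Suc k) = (\<chi> c. \<Theta> 0 $ c + \<eta> (own c) * grad (own c) \<theta> (\<Theta> k) $ c)" for k
    by (simp add: \<Theta>_def grad_def)
  have lip: "norm (grad i \<theta> x - grad i \<theta> y) \<le> Lmax * norm (others_part own i x - others_part own i y)"
    for i x y
    using lipschitz[of i \<theta> x y] mult_right_mono[OF Lmax norm_ge_zero] by (rule order_trans)
  \<comment> \<open>A real supremum is an upper bound only for a set bounded above, hence the appeal
    to \<open>gmax_finite\<close>.\<close>
  have bound: "norm (grad i \<theta> y) \<le> gmax" for i y
    unfolding gmax_def
    using cSUP_upper[OF UNIV_I gmax_finite, of "(i, \<theta>, y)"] by (simp add: grad_def)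
  define r where "r = \<eta>max * Lmax * (n - 1)"
  have inc: "norm (\<Theta> (Suc k) - \<Theta> k) \<le> n * (\<eta>max * gmax * r ^ k)" for k
    unfolding r_def n_def
    using increment_le[where g = "\<lambda>i. grad i \<theta>", OF step _ \<eta>max pos(2) lip bound] rates
    by (simp add: less_imp_le)
  \<comment> \<open>The increment into level \<open>k\<close> has exponent \<open>k - 1\<close>. For
    a single agent and \<open>k = 1\<close> the power \<open>(n - 1) ^ (k - 1)\<close> is
    \<open>0 ^ 0 = 1\<close>.\<close>
  have "norm (\<Theta> k - \<Theta> (k - 1)) \<le> \<eta>max * (\<eta>max * Lmax) ^ (k - 1) * n * (n - 1) ^ (k - 1) * gmax"
    if "1 \<le> k" for k
    using inc[of "k - 1"] that by (simp add: r_def power_mult_distrib mult_ac)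
  \<comment> \<open>In HOL \<open>1 / 0 = 0\<close>, whereas the intended bound on the rate is
    infinite if \<open>Lmax * (n - 1) = 0\<close>. The guard expresses this; the ratio
    \<open>r\<close> is then 0.\<close>
  moreover have "convergent \<Theta>" if small: "Lmax * (n - 1) \<noteq> 0 \<longrightarrow> \<eta>max < 1 / (Lmax * (n - 1))"
  proof (rule convergent_if_geometric_increments)
    show "norm (\<Theta> (Suc k) - \<Theta> k) \<le> n * (\<eta>max * gmax) * r ^ k" for k
      using inc[of k] by (simp add: mult_ac)
    define q where "q = Lmax * (n - 1)"
    have q: "0 \<le> q"
      unfolding q_def using pos n by simp
    have "\<eta>max * q < 1"
      using small q by (cases "q = 0") (simp_all flip: q_def add: pos_less_divide_eq)
    moreover have "r = \<eta>max * q"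
      by (simp add: r_def q_def)
    ultimately show "\<bar>r\<bar> < 1"
      using q pos by simp
  qed
  moreover have "\<Theta> \<longlonglongrightarrow> lim \<Theta> \<and> Cauchy \<Theta> \<and>
      (\<forall>\<epsilon>>0. \<exists>C. \<forall>a b. a > b \<and> b > C \<longrightarrow> norm (\<Theta> a - \<Theta> b) < \<epsilon>)" if "convergent \<Theta>"
  proof -
    have C: "Cauchy \<Theta>"
      using that by (rule convergent_Cauchy)
    have "\<exists>C. \<forall>a b. a > b \<and> b > C \<longrightarrow> norm (\<Theta> a - \<Theta> b) < \<epsilon>" if "\<epsilon> > 0" for \<epsilon>
      \<comment> \<open>The threshold from the Cauchy property serves as \<open>C\<close>, since
        \<open>a > b > C\<close> puts both indices beyond it.\<close>
      using CauchyD[OF C that] by (meson less_imp_le less_trans)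
    with that C show ?thesis
      by (simp add: convergent_LIMSEQ_iff)
  qed
  ultimately show ?thesis
    by blast
qed

end
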